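(* For any optimal reconstructing distributed storage scheme (ORDSS) over a unidirectional ring network with parameters $(n,\alpha,M)$, any storage node can, if it fails, be repaired successfully with repair bandwidth $M$.
   Context: Unidirectional ring network with parameters $(n,\alpha,M)$ (positive integers: $n$ is the number of storage nodes, $\alpha$ the storage capacity per storage node, $M$ the size of the original data): there are $n$ storage nodes $N_1,\dots,N_n$ (indices modulo $n$) forming a directed ring; data can be sent only along the edges $N_j\to N_{j-1}$ (in particular $N_1\to N_n$). For each $i$ there is one user $U_i$, connected only to $N_i$ by an edge $N_i\to U_i$. The original data is a row vector $X\in\mathbb{F}_q^M$ of $M$ symbols over a finite field $\mathbb{F}_q$. Storage scheme (linear): a choice of a finite field $\mathbb{F}_q$ and of matrices $G^{(i)}\in\mathbb{F}_q^{M\times\alpha}$, $1\le i\le n$ (node generator matrices), such that the generator matrix $G=[G^{(1)},\dots,G^{(n)}]\in\mathbb{F}_q^{M\times n\alpha}$ has full row rank $M$. Node $N_i$ stores the $\alpha$ coordinates of $XG^{(i)}$; the $\alpha$ columns of $G^{(i)}$ are called the node vectors of $N_i$. Reconstruction for user $U_i$: a finite sequence of transmissions, each sending one symbol of $\mathbb{F}_q$ along an edge $N_j\to N_{j-1}$ of the ring or along $N_i\to U_i$. A symbol sent by $N_j$ is a fixed $\mathbb{F}_q$-linear combination of the symbols stored at $N_j$ and the symbols previously received by $N_j$; it thus corresponds to a transmitted vector in $\mathbb{F}_q^M$, the same linear combination of the corresponding vectors. User $U_i$ recovers (reconstructs) the original data if the vectors it receives span $\mathbb{F}_q^M$. The reconstructing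 bandwidth is the total number of symbols transmitted over all edges, including the edge $N_i\to U_i$. ORDSS: a storage scheme in which every user $U_i$, $1\le i\le n$, can recover the original data with reconstructing bandwidth exactly $kM-\frac{(k-1)k\alpha}{2}$, where $k=\lceil M/\alpha\rceil$ (this quantity is a lower bound on the reconstructing bandwidth of each user in any storage scheme with these parameters). Repair: when $N_i$ fails, it is replaced by a new node $N_i'$ that takes its place in the ring (it receives from $N_{i+1}$ and sends to $N_{i-1}$) and initially stores nothing. Repair proceeds by a finite sequence of transmissions of single symbols along the ring edges, each being a linear combination of the symbols stored at the sending node and those it previously received. $N_i$ is repaired if $N_i'$ can recover, by linear combinations of the symbols it receives, all $\alpha$ symbols formerly stored at $N_i$, i.e. all $\alpha$ node vectors of $N_i$ lie in the span of the vectors received by $N_i'$. The repair bandwidth is the total number of symbols transmitted over all edges to repair the failed node.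
   Formalization: The formal statement adds k = ⌈M/α⌉ < n; when k = n the n−1 surviving nodes store fewer than M symbols, so no node can be repaired (e.g. n=2, α=1, M=2 with node vectors e_1, e_2), and the claim is false there. *)

theory Defs
  imports Complex_Main "Jordan_Normal_Form.DL_Rank"
begin

(* Nodes are the residues 0, ..., n - 1 modulo n.  The parameters written (n, \<alpha>, M) are the number
   of storage nodes, the capacity of a node, and the size of the data. *)

abbreviation vspan :: "nat \<Rightarrow> 'a::field vec set \<Rightarrow> 'a vec set" where
  "vspan M S \<equiv> LinearCombinations.module.span class_ring (module_vec TYPE('a) M) S"

definition generator_matrix :: "nat \<Rightarrow> nat \<Rightarrow> (nat \<Rightarrow> 'a mat) \<Rightarrow> 'a mat" where
  "generator_matrix n M G = mat_of_cols M (concat (map (\<lambda>j. cols (G j)) [0..<n]))"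

definition storage_scheme :: "nat \<Rightarrow> nat \<Rightarrow> nat \<Rightarrow> (nat \<Rightarrow> 'a::{finite,field} mat) \<Rightarrow> bool" where
  "storage_scheme n \<alpha> M G \<longleftrightarrow>
     0 < n \<and> 0 < \<alpha> \<and> 0 < M \<and>
     (\<forall>j<n. G j \<in> carrier_mat M \<alpha>) \<and>
     vec_space.rank M (generator_matrix n M G) = M"

definition node_vectors :: "(nat \<Rightarrow> 'a mat) \<Rightarrow> nat \<Rightarrow> 'a vec set" where
  "node_vectors G j = set (cols (G j))"

(* RingLink j is the edge from node j to its predecessor j - 1 (mod n);
   UserLink j is the edge from node j to the user attached to it. *)

datatype link = RingLink nat | UserLink nat

fun sender :: "link \<Rightarrow> nat" where
  "sender (RingLink j) = j"
| "sender (UserLink j) = j"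

definition prev_node :: "nat \<Rightarrow> nat \<Rightarrow> nat" where
  "prev_node n j = (j + n - 1) mod n"

(* A transmission scheme is the list, in chronological order, of the transmissions of single symbols.
   The symbol X v (X the data) is represented by its coefficient vector v, so that "fixed linear
   combination of the symbols available at the sender" becomes membership in a span. *)

type_synonym 'a transmissions = "(link \<times> 'a vec) list"

definition node_received :: "nat \<Rightarrow> 'a transmissions \<Rightarrow> nat \<Rightarrow> 'a vec set" where
  "node_received n p v = {x. \<exists>j<n. prev_node n j = v \<and> (RingLink j, x) \<in> set p}"

definition user_received :: "'a transmissions \<Rightarrow> nat \<Rightarrow> 'a vec set" where
  "user_received p i = {x. (UserLink i, x) \<in> set p}"

(* L is the set of usable links, S v the set of vectors initially stored at node v. *)

definition valid_transmissions ::
  "nat \<Rightarrow> nat \<Rightarrow> link set \<Rightarrow> (nat \<Rightarrow> 'a::field vec set) \<Rightarrow> 'a transmissions \<Rightarrow> bool" where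
  "valid_transmissions n M L S p \<longleftrightarrow>
     (\<forall>t<length p. fst (p ! t) \<in> L \<and>
        snd (p ! t) \<in> vspan M (S (sender (fst (p ! t))) \<union>
                               node_received n (take t p) (sender (fst (p ! t)))))"

abbreviation bandwidth :: "'a transmissions \<Rightarrow> nat" where
  "bandwidth p \<equiv> length p"

definition reconstructible ::
  "nat \<Rightarrow> nat \<Rightarrow> (nat \<Rightarrow> 'a::field mat) \<Rightarrow> nat \<Rightarrow> nat \<Rightarrow> bool" where
  "reconstructible n M G i b \<longleftrightarrow>
     (\<exists>p. valid_transmissions n M (insert (UserLink i) (RingLink ` {..<n})) (node_vectors G) p \<and>
          vspan M (user_received p i) = carrier_vec M \<and>
          bandwidth p = b)"

definition num_needed :: "nat \<Rightarrow> nat \<Rightarrow> nat" where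
  "num_needed \<alpha> M = nat \<lceil>real M / real \<alpha>\<rceil>"

(* For positive \<alpha> and M, natural-number arithmetic is harmless here: with k = num_needed \<alpha> M we have
   k \<ge> 1, (k - 1) * \<alpha> < M, and (k - 1) * k is even. *)

definition optimal_reconstructing_bandwidth :: "nat \<Rightarrow> nat \<Rightarrow> nat" where
  "optimal_reconstructing_bandwidth \<alpha> M =
     (let k = num_needed \<alpha> M in k * M - ((k - 1) * k * \<alpha>) div 2)"

definition ordss :: "nat \<Rightarrow> nat \<Rightarrow> nat \<Rightarrow> (nat \<Rightarrow> 'a::{finite,field} mat) \<Rightarrow> bool" where
  "ordss n \<alpha> M G \<longleftrightarrow>
     storage_scheme n \<alpha> M G \<and>
     (\<forall>i<n. reconstructible n M G i (optimal_reconstructing_bandwidth \<alpha> M))"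

(* The replacement of node i keeps the position i in the ring and initially stores nothing. *)

definition repairable ::
  "nat \<Rightarrow> nat \<Rightarrow> (nat \<Rightarrow> 'a::field mat) \<Rightarrow> nat \<Rightarrow> nat \<Rightarrow> bool" where
  "repairable n M G i b \<longleftrightarrow>
     (\<exists>p. valid_transmissions n M (RingLink ` {..<n}) ((node_vectors G)(i := {})) p \<and>
          node_vectors G i \<subseteq> vspan M (node_received n p i) \<and>
          bandwidth p = b)"

end

theory Submission
  imports Defs
begin

text \<open>
  Consider user \<open>U\<^sub>u\<close> with \<open>u = i + 1\<close> and, for \<open>j \<le> k\<close>, the cut around the nodes \<open>u, \<dots>, u + j - 1\<close>.
  The only link entering it is the one from node \<open>u + j\<close> (for \<open>j = 0\<close> the link to the user), so the
  vectors on this link complete the at most \<open>j\<alpha>\<close> vectors stored inside the cut to a spanning set, and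
  there are at least \<open>M - j\<alpha>\<close> of them.  The sum of these bounds is the given bandwidth, so all of
  them are attained: nothing enters node \<open>u + k - 1\<close>, which therefore sends \<open>M - (k - 1)\<alpha>\<close>
  combinations of its own vectors, and these together with the nodes \<open>u, \<dots>, u + k - 2\<close> span the
  whole space.  For the repair of node \<open>i\<close>, node \<open>u + k - 1 = i + k\<close> sends the same vectors, and
  each of the nodes \<open>i + k - 1, \<dots>, i + 1\<close> adds its own contribution to the \<open>\<alpha>\<close> partial sums of the
  lost vectors and sends these on, which costs \<open>M - (k - 1)\<alpha> + (k - 1)\<alpha> = M\<close> symbols.
\<close>

section \<open>Spans of vectors of fixed dimension\<close>

lemma vspan_mono: "A \<subseteq> B \<Longrightarrow> vspan M A \<subseteq> vspan M (B :: 'a::field vec set)"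
proof -
  interpret vec_space "TYPE('a)" M .
  show "A \<subseteq> B \<Longrightarrow> vspan M A \<subseteq> vspan M B" by (rule span_is_monotone)
qed

lemma vspan_carrier:
  fixes A :: "'a::field vec set"
  assumes "A \<subseteq> carrier_vec M"
  shows "vspan M A \<subseteq> carrier_vec M"
proof -
  interpret vec_space "TYPE('a)" M .
  show ?thesis using span_is_subset2 assms by simp
qed

lemma vspan_superset:
  fixes A :: "'a::field vec set"
  assumes "A \<subseteq> carrier_vec M"
  shows "A \<subseteq> vspan M A"
proof -
  interpret vec_space "TYPE('a)" M .
  show ?thesis using in_own_span assms by simp
qed

lemma vspan_minimal:
  fixes A B :: "'a::field vec set"
  assumes "A \<subseteq> vspan M B" "B \<subseteq> carrier_vec M"
  shows "vspan M A \<subseteq> vspan M B"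
proof -
  interpret vec_space "TYPE('a)" M .
  show ?thesis using span_is_subset[OF assms(1)] span_is_submodule assms(2) by simp
qed

lemma vspan_add:
  fixes A :: "'a::field vec set"
  assumes "A \<subseteq> carrier_vec M" "x \<in> vspan M A" "y \<in> vspan M A"
  shows "x + y \<in> vspan M A"
proof -
  interpret vec_space "TYPE('a)" M .
  show ?thesis using span_add1 assms by simp
qed

text \<open>Used to split a lost vector into the contribution of one node and a remainder.\<close>

lemma vspan_Un_decompose:
  fixes A B :: "'a::field vec set"
  assumes "A \<subseteq> carrier_vec M" "B \<subseteq> carrier_vec M" "x \<in> vspan M (A \<union> B)"
  obtains a b where "a \<in> vspan M A" "b \<in> vspan M B" "x = a + b"
proof -
  interpret vec_space "TYPE('a)" M .
  have "x \<in> subspace_sum (span A) (span B)"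
    using span_union_is_sum[of A B] assms by simp
  then show ?thesis using that by (auto simp: submodule_sum_def)
qed

lemma card_spanning_ge:
  fixes A :: "'a::field vec set"
  assumes "finite A" "A \<subseteq> carrier_vec M" "vspan M A = carrier_vec M"
  shows "M \<le> card A"
proof -
  interpret vec_space "TYPE('a)" M .
  show ?thesis using gen_ge_dim[of A] assms dim_is_n by simp
qed

section \<open>Index arithmetic on the ring\<close>

lemma prev_node_shift: "0 < n \<Longrightarrow> prev_node n ((i + Suc d) mod n) = (i + d) mod n"
proof -
  assume n: "0 < n"
  then have "prev_node n ((i + Suc d) mod n) = ((i + Suc d) mod n + (n - 1)) mod n"
    unfolding prev_node_def by simp
  also have "\<dots> = (i + Suc d + (n - 1)) mod n" by (rule mod_add_left_eq)
  also have "i + Suc d + (n - 1) = i + d + n" using n by simp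
  finally show ?thesis by simp
qed

lemma prev_node_eq_shiftD:
  assumes "j < n" "prev_node n j = (i + d) mod n"
  shows "j = (i + Suc d) mod n"
proof -
  have "Suc (j + n - 1) mod n = Suc (i + d) mod n"
    using assms(2) unfolding prev_node_def by (metis mod_Suc_eq)
  then show ?thesis using assms(1) by simp
qed

text \<open>Congruent offsets in a window of \<open>n\<close> consecutive integers differ by a
  multiple of \<open>n\<close> that is below \<open>n\<close>, hence by 0. The start
  \<open>c\<close> allows windows from 0 as well as from 1.\<close>

lemma shift_inj_on:
  assumes "d < n + c" "d' < n + c" "c \<le> d" "c \<le> d'" "(i + d) mod n = (i + d') mod (n::nat)"
  shows "d = d'"
proof -
  have *: "a = b" if "(i + a) mod n = (i + b) mod n" "a \<le> b" "b < n + a" for a b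
  proof -
    have "n dvd (i + b) - (i + a)" using that mod_eq_dvd_iff_nat[of "i + a" "i + b" n] by simp
    then show ?thesis using that by (auto dest: dvd_imp_le)
  qed
  show ?thesis
  proof (cases "d \<le> d'")
    case True
    then show ?thesis using *[of d d'] assms by simp
  next
    case False
    then show ?thesis using *[of d' d] assms by simp
  qed
qed

section \<open>Traffic on single links and across cuts\<close>

text \<open>A list instead of a set, so that \<open>length\<close> counts repeated symbols, as the
  bandwidth does.\<close>

abbreviation carried :: "'a transmissions \<Rightarrow> link \<Rightarrow> 'a vec list" where
  "carried p l \<equiv> map snd (filter (\<lambda>z. fst z = l) p)"

lemma set_carried: "set (carried p l) = {x. (l, x) \<in> set p}"
  by force

lemma node_received_shift:
  assumes "0 < n"
  shows "node_received n p ((i + d) mod n) = set (carried p (RingLink ((i + Suc d) mod n)))"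
  unfolding node_received_def set_carried
  using assms prev_node_shift[of n i d] prev_node_eq_shiftD[of _ n i d]
  by (auto intro!: exI[of _ "(i + Suc d) mod n"] simp del: add_Suc_right)

lemma node_received_mono: "set p \<subseteq> set q \<Longrightarrow> node_received n p v \<subseteq> node_received n q v"
  unfolding node_received_def by auto

text \<open>Each transmission uses one link, so an injective family of links counts it at most
  once.\<close>

lemma sum_length_carried_le:
  assumes "finite J" "inj_on e J"
  shows "(\<Sum>j\<in>J. length (carried p (e j))) \<le> length p"
proof (induction p)
  case (Cons z p)
  have "(\<Sum>j\<in>J. length (carried (z # p) (e j))) =
      (\<Sum>j\<in>J. if fst z = e j then 1 else 0) + (\<Sum>j\<in>J. length (carried p (e j)))"
    unfolding sum.distrib[symmetric] by (intro sum.cong) auto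
  also have "(\<Sum>j\<in>J. if fst z = e j then 1 else 0 :: nat) = card {j \<in> J. fst z = e j}"
    using assms(1) by (simp add: sum.If_cases Int_def)
  also have "\<dots> \<le> 1"
    using assms by (subst One_nat_def, subst card_le_Suc0_iff_eq) (auto dest: inj_onD)
  finally show ?case using Cons by simp
qed simp

text \<open>Strong induction on the time of sending: what a node of \<open>A\<close> has received
  came either from within \<open>A\<close> at an earlier time, or across the boundary and so from
  \<open>X\<close>.\<close>

lemma transmitted_in_cut_span:
  fixes p :: "'a::field transmissions"
  assumes valid: "valid_transmissions n M L S p"
    and S: "\<And>v. v \<in> A \<Longrightarrow> S v \<subseteq> carrier_vec M"
    and X: "X \<subseteq> carrier_vec M"
    and entering: "\<And>j x. \<lbrakk>j < n; prev_node n j \<in> A; (RingLink j, x) \<in> set p; j \<notin> A\<rbrakk> \<Longrightarrow> x \<in> X"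
    and "(l, x) \<in> set p" "sender l \<in> A"
  shows "x \<in> vspan M (\<Union>(S ` A) \<union> X)"
proof -
  let ?W = "\<Union>(S ` A) \<union> X"
  have W: "?W \<subseteq> carrier_vec M" using S X by auto
  have "t < length p \<longrightarrow> sender (fst (p ! t)) \<in> A \<longrightarrow> snd (p ! t) \<in> vspan M ?W" for t
  proof (induction t rule: less_induct)
    case (less t)
    show ?case
    proof (intro impI)
      assume t: "t < length p" and A: "sender (fst (p ! t)) \<in> A"
      let ?v = "sender (fst (p ! t))"
      have "node_received n (take t p) ?v \<subseteq> vspan M ?W"
      proof
        fix y assume "y \<in> node_received n (take t p) ?v"
        then obtain j where j: "j < n" "prev_node n j = ?v" "(RingLink j, y) \<in> set (take t p)"
          unfolding node_received_def by auto
        then obtain s where s: "s < t" "p ! s = (RingLink j, y)"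
          using t by (auto simp: in_set_conv_nth)
        show "y \<in> vspan M ?W"
        proof (cases "j \<in> A")
          case True
          then show ?thesis using less[OF s(1)] s t by simp
        next
          case False
          then have "y \<in> ?W" using entering[of j y] j A by (auto dest: in_set_takeD)
          then show ?thesis using vspan_superset[OF W] by auto
        qed
      qed
      moreover have "S ?v \<subseteq> vspan M ?W" using vspan_superset[OF W] A by auto
      ultimately have "vspan M (S ?v \<union> node_received n (take t p) ?v) \<subseteq> vspan M ?W"
        using vspan_minimal[OF _ W] by simp
      then show "snd (p ! t) \<in> vspan M ?W"
        using valid t unfolding valid_transmissions_def by auto
    qed
  qed
  moreover obtain t where "t < length p" "p ! t = (l, x)"
    using assms(5) by (auto simp: in_set_conv_nth)
  ultimately show ?thesis using assms(6) by (metis fst_conv snd_conv)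
qed

text \<open>Nothing enters the cut that contains every sender, so all traffic lies in the span of
  the stored vectors.\<close>

lemma transmitted_carrier:
  fixes p :: "'a::field transmissions"
  assumes "valid_transmissions n M L S p"
    and "\<And>v. v \<in> sender ` L \<Longrightarrow> S v \<subseteq> carrier_vec M"
    and "(l, x) \<in> set p"
  shows "x \<in> carrier_vec M"
proof -
  have L: "l' \<in> L" if "(l', y) \<in> set p" for l' y
    using that assms(1) unfolding valid_transmissions_def by (force simp: in_set_conv_nth)
  have "x \<in> vspan M (\<Union>(S ` (sender ` L)) \<union> {})"
    by (rule transmitted_in_cut_span[OF assms(1) assms(2) _ _ assms(3)])
      (use L assms(3) in \<open>force+\<close>)
  then show ?thesis
    using vspan_carrier[of "\<Union>(S ` (sender ` L)) \<union> {}" M] assms(2) by blast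
qed

text \<open>The appended symbols draw only on what arrived during \<open>p\<close>, never on one
  another; one round of a relay has this shape.\<close>

lemma valid_transmissions_append:
  assumes "valid_transmissions n M L S p"
    and "\<And>l x. (l, x) \<in> set q \<Longrightarrow>
      l \<in> L \<and> x \<in> vspan M (S (sender l) \<union> node_received n p (sender l))"
  shows "valid_transmissions n M L S (p @ q)"
  unfolding valid_transmissions_def
proof (intro allI impI)
  fix t assume t: "t < length (p @ q)"
  show "fst ((p @ q) ! t) \<in> L \<and> snd ((p @ q) ! t) \<in> vspan M (S (sender (fst ((p @ q) ! t)))
    \<union> node_received n (take t (p @ q)) (sender (fst ((p @ q) ! t))))"
  proof (cases "t < length p")
    case True
    then show ?thesis using assms(1) unfolding valid_transmissions_def by (simp add: nth_append)
  next
    case False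
    obtain l x where lx: "(p @ q) ! t = (l, x)" by force
    then have "(l, x) \<in> set q" using False t by (metis nth_append nth_mem length_append
          add_less_cancel_left le_add_diff_inverse linorder_not_less)
    moreover have "node_received n p (sender l) \<subseteq> node_received n (take t (p @ q)) (sender l)"
      by (rule node_received_mono) (use False in auto)
    then have "vspan M (S (sender l) \<union> node_received n p (sender l)) \<subseteq>
        vspan M (S (sender l) \<union> node_received n (take t (p @ q)) (sender l))"
      by (intro vspan_mono) auto
    ultimately show ?thesis using assms(2) lx by auto
  qed
qed

section \<open>Arithmetic of the optimal bandwidth\<close>

lemma num_needed_bounds:
  assumes "0 < \<alpha>" "0 < M"
  shows "0 < num_needed \<alpha> M" "(num_needed \<alpha> M - 1) * \<alpha> < M"
proof -
  let ?k = "num_needed \<alpha> M"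
  have pos: "0 < real M / real \<alpha>" using assms by simp
  then show k: "0 < ?k" unfolding num_needed_def by simp
  have "real ?k = of_int \<lceil>real M / real \<alpha>\<rceil>" unfolding num_needed_def using pos by simp
  then have "real (?k - 1) < real M / real \<alpha>"
    using k ceiling_correct[of "real M / real \<alpha>"] by (simp add: of_nat_diff)
  then have "real ((?k - 1) * \<alpha>) < real M" using assms by (simp add: field_simps)
  then show "(?k - 1) * \<alpha> < M" by linarith
qed

text \<open>Summand \<open>j\<close> is the lower bound for the \<open>j\<close>-th cut. No
  subtraction truncates, as \<open>j * \<alpha> \<le> (k - 1) * \<alpha> < M\<close> with
  \<open>k = num_needed \<alpha> M\<close>.\<close>

lemma optimal_reconstructing_bandwidth_eq_sum:
  assumes "0 < \<alpha>" "0 < M"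
  shows "optimal_reconstructing_bandwidth \<alpha> M = (\<Sum>j<num_needed \<alpha> M. M - j * \<alpha>)"
proof -
  let ?k = "num_needed \<alpha> M"
  have "(\<Sum>j<?k. M - j * \<alpha>) + (\<Sum>j<?k. j * \<alpha>) = (\<Sum>j<?k. M)"
    unfolding sum.distrib[symmetric]
  proof (rule sum.cong)
    fix j assume "j \<in> {..<?k}"
    then have "j * \<alpha> \<le> (?k - 1) * \<alpha>" by (intro mult_right_mono) auto
    then show "M - j * \<alpha> + j * \<alpha> = M" using num_needed_bounds(2)[OF assms] by linarith
  qed simp
  moreover have "(m - 1) * m * \<alpha> div 2 = (\<Sum>j<m. j * \<alpha>)" for m
  proof -
    have "2 * (\<Sum>j<m. j) = (m - 1) * m"
    proof (induction m)
      case (Suc m)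
      then show ?case by (cases m) auto
    qed simp
    then have "(m - 1) * m * \<alpha> = 2 * (\<Sum>j<m. j * \<alpha>)"
      by (simp flip: sum_distrib_right mult.assoc)
    then show ?thesis by simp
  qed
  ultimately show ?thesis unfolding optimal_reconstructing_bandwidth_def by (simp add: Let_def)
qed

section \<open>Structure of an optimal download\<close>

text \<open>The list \<open>xs\<close> is what crosses the cut \<open>j = k - 1\<close> in the download of user \<open>i + 1\<close>.\<close>

lemma optimal_reconstruction_structure:
  fixes G :: "nat \<Rightarrow> 'a::field mat"
  assumes pos: "0 < \<alpha>" "0 < M"
    and G: "\<And>v. v < n \<Longrightarrow> G v \<in> carrier_mat M \<alpha>"
    and k: "num_needed \<alpha> M < n"
    and rec: "reconstructible n M G (Suc i mod n) (optimal_reconstructing_bandwidth \<alpha> M)"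
  obtains xs where "length xs = M - (num_needed \<alpha> M - 1) * \<alpha>"
    and "set xs \<subseteq> vspan M (node_vectors G ((i + num_needed \<alpha> M) mod n))"
    and "vspan M ((\<Union>d\<in>{1..num_needed \<alpha> M - 1}. node_vectors G ((i + d) mod n)) \<union> set xs) =
      carrier_vec M"
proof -
  define k where "k = num_needed \<alpha> M"
  define u where "u = Suc i mod n"
  define nd where "nd d = (i + d) mod n" for d
  \<comment> \<open>\<open>nd 1\<close> is \<open>u\<close>, and \<open>e j\<close> is the link
    through which outside data can enter the cut \<open>nd 1\<close>, ..., \<open>nd j\<close>; for
    \<open>j = 0\<close> only the user is inside.\<close>
  define e where "e j = (if j = 0 then UserLink u else RingLink (nd (Suc j)))" for j
  let ?L = "insert (UserLink u) (RingLink ` {..<n})"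
  let ?W = "\<lambda>j. \<Union>(node_vectors G ` (nd ` {1..j}))"
  have n: "0 < n" and kn: "k < n" using k k_def by auto
  have k0: "0 < k" using num_needed_bounds(1)[OF pos] k_def by simp
  have nd: "nd d < n" for d using n nd_def by simp
  have sender_e: "sender (e j) = nd (Suc j)" for j
    by (simp add: e_def u_def nd_def)
  obtain p where valid: "valid_transmissions n M ?L (node_vectors G) p"
    and user: "vspan M (user_received p u) = carrier_vec M"
    and len: "length p = (\<Sum>j<k. M - j * \<alpha>)"
    using rec optimal_reconstructing_bandwidth_eq_sum[OF pos] k_def u_def
    unfolding reconstructible_def by auto
  have nv: "node_vectors G v \<subseteq> carrier_vec M" if "v < n" for v
    using G[OF that] cols_dim[of "G v"] unfolding node_vectors_def by auto
  have card_nv: "card (node_vectors G v) \<le> \<alpha>" if "v < n" for v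
    using G[OF that] card_length[of "cols (G v)"] unfolding node_vectors_def by simp
  have "v < n" if "v \<in> sender ` ?L" for v
    using that n u_def by auto
  then have p_carrier: "x \<in> carrier_vec M" if "(l, x) \<in> set p" for l x
    using transmitted_carrier[OF valid _ that] nv by blast
  have carried_carrier: "set (carried p l) \<subseteq> carrier_vec M" for l
    unfolding set_carried using p_carrier by auto
  have W_carrier: "?W j \<subseteq> carrier_vec M" for j using nv nd by blast
  have span: "vspan M (?W j \<union> set (carried p (e j))) = carrier_vec M" if "j \<le> k" for j
  proof
    show "vspan M (?W j \<union> set (carried p (e j))) \<subseteq> carrier_vec M"
      using W_carrier carried_carrier by (intro vspan_carrier) blast
    have "user_received p u \<subseteq> vspan M (?W j \<union> set (carried p (e j)))"
    proof (cases "j = 0")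
      case True
      then have "user_received p u = ?W j \<union> set (carried p (e j))"
        unfolding user_received_def set_carried e_def by simp
      then show ?thesis
        using vspan_superset W_carrier carried_carrier by (metis Un_subset_iff)
    next
      case False
      show ?thesis
      proof
        fix x assume "x \<in> user_received p u"
        then have x: "(UserLink u, x) \<in> set p" unfolding user_received_def by simp
        \<comment> \<open>\<open>u\<close> lies in the cut, so whatever it delivers is generated by
          the stores inside and the traffic on \<open>e j\<close>.\<close>
        show "x \<in> vspan M (?W j \<union> set (carried p (e j)))"
        proof (rule transmitted_in_cut_span[OF valid _ carried_carrier _ x])
          show "node_vectors G v \<subseteq> carrier_vec M" if "v \<in> nd ` {1..j}" for v
            using that nv nd by auto
          have "u = nd 1" unfolding u_def nd_def by simp
          then show "sender (UserLink u) \<in> nd ` {1..j}" using False by auto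
          fix m y assume m: "m < n" "prev_node n m \<in> nd ` {1..j}" "(RingLink m, y) \<in> set p"
            "m \<notin> nd ` {1..j}"
          then obtain d where d: "d \<in> {1..j}" "prev_node n m = nd d" by auto
          then have "m = nd (Suc d)" using prev_node_eq_shiftD m(1) unfolding nd_def by blast
          moreover have "Suc d \<notin> {1..j}" using m(4) calculation by blast
          \<comment> \<open>One step up from \<open>d\<close> leaves \<open>{1..j}\<close> only if
            \<open>d = j\<close>.\<close>
          ultimately have "m = nd (Suc j)" using d(1) by (auto simp: le_Suc_eq not_less_eq_eq)
          then show "y \<in> set (carried p (e j))" using m(3) False unfolding set_carried e_def by simp
        qed
      qed
    qed
    then show "carrier_vec M \<subseteq> vspan M (?W j \<union> set (carried p (e j)))"
      unfolding user[symmetric] using W_carrier carried_carrier by (intro vspan_minimal) blast+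
  qed
  have lower: "M - j * \<alpha> \<le> length (carried p (e j))" if "j \<le> k" for j
  proof -
    have W_UN: "?W j = (\<Union>d\<in>{1..j}. node_vectors G (nd d))" by auto
    have "card (?W j) \<le> (\<Sum>d\<in>{1..j}. card (node_vectors G (nd d)))"
      unfolding W_UN by (rule card_UN_le) simp
    also have "\<dots> \<le> (\<Sum>d\<in>{1..j}. \<alpha>)" using card_nv nd by (intro sum_mono) auto
    finally have "card (?W j) \<le> j * \<alpha>" by simp
    moreover have "finite (?W j)" unfolding node_vectors_def by auto
    then have "M \<le> card (?W j \<union> set (carried p (e j)))"
      using span[OF that] W_carrier carried_carrier by (intro card_spanning_ge) auto
    ultimately show ?thesis
      using card_Un_le[of "?W j" "set (carried p (e j))"] card_length[of "carried p (e j)"]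
      by linarith
  qed
  \<comment> \<open>Here \<open>k < n\<close> enters: the senders of \<open>e 1\<close>, ...,
    \<open>e k\<close> have offsets 2 to \<open>k + 1\<close>, inside a window of \<open>n\<close>
    integers from 1. The index \<open>k\<close> is included because \<open>e k\<close> is to be
    shown idle.\<close>
  have "inj_on e {..k}"
  proof (rule inj_onI)
    fix a b assume ab: "a \<in> {..k}" "b \<in> {..k}" "e a = e b"
    show "a = b"
    proof (cases "a = 0 \<or> b = 0")
      case True
      then show ?thesis using ab(3) unfolding e_def by (auto split: if_splits)
    next
      case False
      then have "(i + Suc a) mod n = (i + Suc b) mod n" using ab(3) unfolding e_def nd_def by simp
      then have "Suc a = Suc b"
        using shift_inj_on[of "Suc a" n 1 "Suc b" i] ab(1,2) kn by simp
      then show ?thesis by simp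
    qed
  qed
  from sum_length_carried_le[OF _ this, of p]
  have total: "(\<Sum>j<k. length (carried p (e j))) + length (carried p (e k)) \<le> (\<Sum>j<k. M - j * \<alpha>)"
    unfolding len by (simp add: lessThan_Suc_atMost[symmetric])
  \<comment> \<open>The bounds for \<open>j < k\<close> already exhaust the budget, which leaves
    nothing for \<open>e k\<close> and no slack in any single bound.\<close>
  have "(\<Sum>j<k. M - j * \<alpha>) \<le> (\<Sum>j<k. length (carried p (e j)))"
    by (intro sum_mono lower) simp
  then have "length (carried p (e k)) = 0"
    and eq: "(\<Sum>j<k. length (carried p (e j))) = (\<Sum>j<k. M - j * \<alpha>)"
    using total by linarith+
  then have none: "carried p (e k) = []" by simp
  have "M - j * \<alpha> = length (carried p (e j))" if "j < k" for j
    using sum_mono_inv[OF eq[symmetric], of j] lower that by auto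
  \<comment> \<open>For \<open>k = 1\<close> the link \<open>e (k - 1)\<close> is the one to the
    user.\<close>
  from this[of "k - 1"] have "length (carried p (e (k - 1))) = M - (k - 1) * \<alpha>"
    using k0 by simp
  moreover have "set (carried p (e (k - 1))) \<subseteq> vspan M (node_vectors G (nd k))"
  proof
    fix x assume "x \<in> set (carried p (e (k - 1)))"
    then have x: "(e (k - 1), x) \<in> set p" unfolding set_carried by simp
    \<comment> \<open>A cut around \<open>nd k\<close> alone: its entering link \<open>e k\<close>
      is idle, so the set of entering vectors is empty.\<close>
    have "x \<in> vspan M (\<Union>(node_vectors G ` {nd k}) \<union> {})"
    proof (rule transmitted_in_cut_span[OF valid _ _ _ x])
      show "sender (e (k - 1)) \<in> {nd k}" using sender_e[of "k - 1"] k0 by simp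
      fix m y assume "m < n" "prev_node n m \<in> {nd k}" and y: "(RingLink m, y) \<in> set p"
      then have "m = nd (Suc k)" using prev_node_eq_shiftD unfolding nd_def by blast
      then have "y \<in> set (carried p (e k))" using y k0 unfolding set_carried e_def by simp
      then show "y \<in> {}" using none by simp
    qed (use nv nd in auto)
    then show "x \<in> vspan M (node_vectors G (nd k))" by simp
  qed
  moreover have "?W (k - 1) = (\<Union>d\<in>{1..k - 1}. node_vectors G (nd d))" by auto
  ultimately show ?thesis
    using that[of "carried p (e (k - 1))"] span[of "k - 1"]
    unfolding k_def nd_def by auto
qed

section \<open>Repair by relaying partial sums\<close>

text \<open>Induction on the number \<open>r\<close> of relaying nodes, with \<open>vs\<close>
  arbitrary because the hypothesis is applied to the remainders left when one node's contributions
  are removed. The first hop costs \<open>length xs\<close>, each later one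
  \<open>length vs\<close>.\<close>

lemma relay_partial_sums:
  fixes S :: "nat \<Rightarrow> 'a::field vec set"
  assumes n: "0 < n"
    and S: "\<And>v. v < n \<Longrightarrow> S v \<subseteq> carrier_vec M"
    and xs: "set xs \<subseteq> vspan M (S ((i + k) mod n))"
    and k: "0 < k" and r: "r < k"
    and vs: "set vs \<subseteq> vspan M ((\<Union>d\<in>{k - r..<k}. S ((i + d) mod n)) \<union> set xs)"
  shows "\<exists>p. valid_transmissions n M (RingLink ` {..<n}) S p \<and>
    set vs \<subseteq> vspan M (node_received n p ((i + (k - Suc r)) mod n)) \<and>
    length p = length xs + r * length vs"
  using r vs
proof (induction r arbitrary: vs)
  case 0
  \<comment> \<open>The node at offset \<open>k\<close> sends \<open>xs\<close>, whose span already
    contains \<open>vs\<close> when nobody else contributes.\<close>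
  let ?p = "map (Pair (RingLink ((i + k) mod n))) xs"
  have "valid_transmissions n M (RingLink ` {..<n}) S ([] @ ?p)"
  proof (rule valid_transmissions_append)
    show "valid_transmissions n M (RingLink ` {..<n}) S []"
      unfolding valid_transmissions_def by simp
    show "l \<in> RingLink ` {..<n} \<and> x \<in> vspan M (S (sender l) \<union> node_received n [] (sender l))"
      if "(l, x) \<in> set ?p" for l x
      using that xs n by (auto simp: node_received_def)
  qed
  moreover have "node_received n ?p ((i + (k - 1)) mod n) = set xs"
    unfolding node_received_shift[OF n] set_carried using k by auto
  ultimately show ?case using 0 by (intro exI[of _ ?p]) simp
next
  case (Suc r)
  \<comment> \<open>\<open>d\<close> is the offset of the node that joins the relay in this round:
    it receives the remainders \<open>g x\<close>, adds \<open>f x\<close> from its own store and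
    sends the sums \<open>x\<close>.\<close>
  define d where "d = k - Suc r"
  have d: "0 < d" "d < k" using Suc.prems(1) d_def by auto
  let ?v = "(i + d) mod n"
  let ?R = "(\<Union>c\<in>{k - r..<k}. S ((i + c) mod n)) \<union> set xs"
  have xs_carrier: "set xs \<subseteq> carrier_vec M"
    using xs vspan_carrier[OF S[of "(i + k) mod n"]] n by simp
  have R: "?R \<subseteq> carrier_vec M" using S n by (intro Un_least UN_least xs_carrier) simp
  have Sv: "S ?v \<subseteq> carrier_vec M" using S n by simp
  have "{k - Suc r..<k} = insert d {k - r..<k}" using Suc.prems(1) unfolding d_def by auto
  then have split: "(\<Union>c\<in>{k - Suc r..<k}. S ((i + c) mod n)) \<union> set xs = S ?v \<union> ?R" by auto
  have "\<exists>a b. a \<in> vspan M (S ?v) \<and> b \<in> vspan M ?R \<and> x = a + b" if "x \<in> set vs" for x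
    using Suc.prems(2) that vspan_Un_decompose[OF Sv R, of x] unfolding split by blast
  then obtain f g where fg: "\<And>x. x \<in> set vs \<Longrightarrow> f x \<in> vspan M (S ?v) \<and> g x \<in> vspan M ?R \<and> x = f x + g x"
    by metis
  \<comment> \<open>Mapping over the list keeps the count at \<open>length vs\<close> even if some
    \<open>g x\<close> coincide.\<close>
  have "set (map g vs) \<subseteq> vspan M ?R" using fg by auto
  from Suc.IH[OF _ this] Suc.prems(1) obtain p where
    p: "valid_transmissions n M (RingLink ` {..<n}) S p"
      "set (map g vs) \<subseteq> vspan M (node_received n p ?v)"
      "length p = length xs + r * length vs"
    unfolding d_def by auto
  let ?q = "map (Pair (RingLink ?v)) vs"
  have received: "node_received n q v \<subseteq> carrier_vec M"
    if "valid_transmissions n M (RingLink ` {..<n}) S q" for q v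
  proof
    fix y assume "y \<in> node_received n q v"
    then obtain j where "(RingLink j, y) \<in> set q" unfolding node_received_def by auto
    moreover have "S w \<subseteq> carrier_vec M" if "w \<in> sender ` RingLink ` {..<n}" for w
      using that by (intro S) auto
    ultimately show "y \<in> carrier_vec M" using transmitted_carrier[OF that] by blast
  qed
  have pq: "valid_transmissions n M (RingLink ` {..<n}) S (p @ ?q)"
  proof (rule valid_transmissions_append[OF p(1)])
    fix l x assume "(l, x) \<in> set ?q"
    then have l: "l = RingLink ?v" and x: "x \<in> set vs" by auto
    let ?T = "S ?v \<union> node_received n p ?v"
    have "f x \<in> vspan M ?T" using fg[OF x] vspan_mono[of "S ?v" ?T M] by auto
    moreover have "g x \<in> vspan M ?T"
      using p(2) x vspan_mono[of "node_received n p ?v" ?T M] by auto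
    ultimately have "f x + g x \<in> vspan M ?T" using Sv received[OF p(1)] by (intro vspan_add) auto
    then show "l \<in> RingLink ` {..<n} \<and> x \<in> vspan M (S (sender l) \<union> node_received n p (sender l))"
      using fg[OF x] l n by simp
  qed
  moreover have "set vs \<subseteq> vspan M (node_received n (p @ ?q) ((i + (k - Suc (Suc r))) mod n))"
  proof -
    \<comment> \<open>\<open>Suc r < k\<close> keeps the subtraction from truncating.\<close>
    have *: "Suc (k - Suc (Suc r)) = d" using d unfolding d_def by simp
    have "set vs \<subseteq> node_received n (p @ ?q) ((i + (k - Suc (Suc r))) mod n)"
      unfolding node_received_shift[OF n] set_carried * by auto
    then show ?thesis using vspan_superset[OF received[OF pq]] by blast
  qed
  ultimately show ?case using p(3) by (intro exI[of _ "p @ ?q"]) simp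
qed

theorem theorem5:
  fixes n \<alpha> M i :: nat and G :: "nat \<Rightarrow> 'a::{finite,field} mat"
  assumes "ordss n \<alpha> M G"
    and "num_needed \<alpha> M < n"
    and "i < n"
  shows "repairable n M G i M"
proof -
  define k where "k = num_needed \<alpha> M"
  have pos: "0 < \<alpha>" "0 < M" and G: "\<And>v. v < n \<Longrightarrow> G v \<in> carrier_mat M \<alpha>"
    using assms(1) unfolding ordss_def storage_scheme_def by auto
  have n: "0 < n" using assms(3) by simp
  have k: "0 < k" "(k - 1) * \<alpha> < M" "k < n"
    using num_needed_bounds[OF pos] assms(2) unfolding k_def by auto
  \<comment> \<open>This user is chosen because its optimal download constrains the nodes at offsets
    1 to \<open>k\<close> from \<open>i\<close>, the ones directly upstream of the failed
    node.\<close>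
  have "reconstructible n M G (Suc i mod n) (optimal_reconstructing_bandwidth \<alpha> M)"
    using assms(1) n unfolding ordss_def by simp
  from optimal_reconstruction_structure[OF pos G assms(2) this, folded k_def]
  obtain xs where xs: "length xs = M - (k - 1) * \<alpha>"
      "set xs \<subseteq> vspan M (node_vectors G ((i + k) mod n))"
      "vspan M ((\<Union>d\<in>{1..k - 1}. node_vectors G ((i + d) mod n)) \<union> set xs) = carrier_vec M"
    by blast
  let ?S = "(node_vectors G)(i := {})"
  have nv: "node_vectors G v \<subseteq> carrier_vec M" if "v < n" for v
    using G[OF that] cols_dim[of "G v"] unfolding node_vectors_def by auto
  \<comment> \<open>Since \<open>k < n\<close>, no helper is the failed node, so emptying its store
    leaves theirs unchanged.\<close>
  have "(i + d) mod n \<noteq> i" if "d \<in> {1..k}" for d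
    using shift_inj_on[of d n 0 0 i] that k(3) assms(3) by auto
  then have S: "?S ((i + d) mod n) = node_vectors G ((i + d) mod n)" if "d \<in> {1..k}" for d
    using that by simp
  have ivl: "{k - (k - 1)..<k} = {1..k - 1}" using k(1) by auto
  have "(\<Union>d\<in>{1..k - 1}. ?S ((i + d) mod n)) = (\<Union>d\<in>{1..k - 1}. node_vectors G ((i + d) mod n))"
  proof (intro SUP_cong refl)
    fix d assume "d \<in> {1..k - 1}"
    then have "d \<in> {1..k}" by auto
    then show "?S ((i + d) mod n) = node_vectors G ((i + d) mod n)" by (rule S)
  qed
  then have "set (cols (G i)) \<subseteq> vspan M ((\<Union>d\<in>{k - (k - 1)..<k}. ?S ((i + d) mod n)) \<union> set xs)"
    unfolding ivl using xs(3) nv[OF assms(3)] by (simp add: node_vectors_def)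
  moreover have "set xs \<subseteq> vspan M (?S ((i + k) mod n))" using xs(2) S[of k] k(1) by simp
  \<comment> \<open>With \<open>r = k - 1\<close> the nodes at offsets \<open>k - 1\<close> down to
    1 all relay, and the final receiver has offset 0, so it is the replacement of node
    \<open>i\<close>.\<close>
  ultimately have "\<exists>p. valid_transmissions n M (RingLink ` {..<n}) ?S p \<and>
      set (cols (G i)) \<subseteq> vspan M (node_received n p ((i + (k - Suc (k - 1))) mod n)) \<and>
      length p = length xs + (k - 1) * length (cols (G i))"
    using relay_partial_sums[OF n, of ?S M xs i k "k - 1" "cols (G i)"] nv k(1) by simp
  moreover have "length (cols (G i)) = \<alpha>" using G[OF assms(3)] by simp
  \<comment> \<open>The cost \<open>M - (k - 1) * \<alpha> + (k - 1) * \<alpha>\<close> equals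
    \<open>M\<close> because \<open>(k - 1) * \<alpha> < M\<close>.\<close>
  ultimately show ?thesis
    unfolding repairable_def node_vectors_def using xs(1) k assms(3) by (simp add: node_vectors_def)
qed

end
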